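(* Let $\mathcal{P}$ be a finite set of price vectors, let $\mathcal{U}$ be a convex set, and suppose that $R(\mathbf{p},\mathbf{u})$ is convex in $\mathbf{u}\in\mathcal{U}$ for every $\mathbf{p}\in\mathcal{P}$. Then $$\max_{\boldsymbol{\pi}\in\Delta_{\mathcal{P}}} \min_{\mathbf{u}\in\mathcal{U}} \sum_{\mathbf{p}\in\mathcal{P}} \pi_{\mathbf{p}} R(\mathbf{p},\mathbf{u}) = \min_{\mathbf{u}\in\mathcal{U}} \max_{\mathbf{p}\in\mathcal{P}} R(\mathbf{p},\mathbf{u}),$$ and the common value is the optimal value of the problem of minimizing $t$ over $(t,\mathbf{u})\in\mathbb{R}\times\mathcal{U}$ subject to $t\ge R(\mathbf{p},\mathbf{u})$ for all $\mathbf{p}\in\mathcal{P}$.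
   Context: $\mathcal{P}\subseteq\mathbb{R}_+^I$ is (nonempty and) finite, $\mathcal{U}\subseteq\mathbb{R}^M$ is (nonempty and) convex, $R:\mathcal{P}\times\mathcal{U}\to\mathbb{R}$ is the revenue function, and $\Delta_{\mathcal{P}} = \{\boldsymbol{\pi}\in\mathbb{R}^{\mathcal{P}} : \sum_{\mathbf{p}\in\mathcal{P}}\pi_{\mathbf{p}}=1,\ \pi_{\mathbf{p}}\ge 0\ \forall \mathbf{p}\in\mathcal{P}\}$. Here $\max$ and $\min$ denote optimal values (supremum and infimum). *)

theory Defs
  imports "HOL-Analysis.Analysis"
begin

text \<open>Elements of \<open>\<real>\<^sup>P\<close> are functions that are \<open>undefined\<close> outside of \<open>P\<close>.\<close>

definition prob_simplex :: "'a set \<Rightarrow> ('a \<Rightarrow> real) set" where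
  "prob_simplex P = {\<pi> \<in> P \<rightarrow>\<^sub>E UNIV. (\<Sum>p\<in>P. \<pi> p) = 1 \<and> (\<forall>p\<in>P. 0 \<le> \<pi> p)}"

end

theory Submission
  imports Defs
begin

text \<open>
  The inequality \<open>\<le>\<close> is weak duality. For the converse it suffices to show: if finitely many convex
  functions have pointwise maximum at least \<open>c\<close> on \<open>U\<close>, then so does one of their convex
  combinations. For two functions \<open>a\<close> and \<open>b\<close> (and \<open>c = 0\<close>), the points with \<open>b < 0\<close> bound the
  weight from below and those with \<open>a < 0\<close> bound it from above; the bounds are compatible, since
  otherwise both functions would be negative somewhere on the segment between two such points. For
  more functions, a convex combination of all but one is obtained by induction on the convex set
  where the remaining one is negative, and the two-function case applies to the resulting pair.
\<close>

text \<open>Compatibility of the two kinds of bounds on the weight: after division by positive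
  differences it reads \<open>- b v / (a v - b v) \<le> b u / (b u - a u)\<close>.\<close>

lemma convex_alternative_cross_le:
  fixes a b :: "'v::real_vector \<Rightarrow> real"
  assumes a: "convex_on U a" and b: "convex_on U b"
    and max: "\<And>w. w \<in> U \<Longrightarrow> 0 \<le> a w \<or> 0 \<le> b w"
    and u: "u \<in> U" "a u < 0" and v: "v \<in> U" "b v < 0"
  shows "a u * b v \<le> b u * a v"
proof (rule ccontr)
  assume "\<not> a u * b v \<le> b u * a v"
  then have neg: "b u * a v < a u * b v" by simp
  have bu: "0 \<le> b u" using max[of u] u by auto
  have av: "0 \<le> a v" using max[of v] v by auto
  have pos: "0 < b u - b v" "0 < a v - a u" using bu av u v by auto
  \<comment> \<open>These are the zeros of the chords of \<open>b\<close> and \<open>a\<close> along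
    the segment from \<open>u\<close> to \<open>v\<close>. By \<open>neg\<close>, the chord of
    \<open>b\<close> turns negative before that of \<open>a\<close> stops being negative, so any
    \<open>t\<close> in between makes both functions negative.\<close>
  have "b u / (b u - b v) < - a u / (a v - a u)"
    using neg pos by (simp add: divide_simps algebra_simps)
  then obtain t where t: "b u / (b u - b v) < t" "t < - a u / (a v - a u)"
    using dense by blast
  have "0 \<le> b u / (b u - b v)" "- a u / (a v - a u) \<le> 1"
    using bu av pos by (simp_all add: divide_simps)
  then have t01: "0 \<le> t" "t \<le> 1" using t by linarith+
  define w where "w = (1 - t) *\<^sub>R u + t *\<^sub>R v"
  have w: "w \<in> U"
    unfolding w_def using convex_on_imp_convex[OF a] u(1) v(1) t01 by (simp add: convexD_alt)
  have "a w \<le> (1 - t) * a u + t * a v"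
    unfolding w_def using convex_onD[OF a t01 u(1) v(1)] .
  also have "\<dots> < 0" using t(2) pos(2) by (simp only: pos_less_divide_eq) (simp add: algebra_simps)
  finally have aw: "a w < 0" .
  have "b w \<le> (1 - t) * b u + t * b v"
    unfolding w_def using convex_onD[OF b t01 u(1) v(1)] .
  also have "\<dots> < 0" using t(1) pos(1) by (simp add: pos_divide_less_eq algebra_simps)
  finally show False using aw max[OF w] by simp
qed

lemma convex_alternative_two:
  fixes a b :: "'v::real_vector \<Rightarrow> real"
  assumes a: "convex_on U a" and b: "convex_on U b"
    and max: "\<And>w. w \<in> U \<Longrightarrow> 0 \<le> a w \<or> 0 \<le> b w"
  obtains l where "0 \<le> l" "l \<le> 1" "\<And>u. u \<in> U \<Longrightarrow> 0 \<le> l * a u + (1 - l) * b u"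
proof -
  \<comment> \<open>For \<open>b v < 0\<close> the required inequality at \<open>v\<close> amounts
    to \<open>l\<close> being at least \<open>- b v / (a v - b v)\<close>. Inserting
    \<open>0\<close> makes \<open>L\<close> nonempty and its supremum nonnegative.\<close>
  define L where "L = insert 0 {- b v / (a v - b v) | v. v \<in> U \<and> b v < 0}"
  have pos_a: "0 \<le> a v" if "v \<in> U" "b v < 0" for v using max[of v] that by auto
  have pos_b: "0 \<le> b u" if "u \<in> U" "a u < 0" for u using max[of u] that by auto
  have le1: "x \<le> 1" if "x \<in> L" for x
    using that pos_a unfolding L_def by (fastforce simp: divide_simps)
  then have bdd: "bdd_above L" by (rule bdd_aboveI)
  \<comment> \<open>A point with \<open>a u < 0\<close> caps the weight at
    \<open>b u / (b u - a u)\<close>. All of \<open>L\<close> obeys the cap, hence so does its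
    supremum.\<close>
  have up: "x \<le> b u / (b u - a u)" if x: "x \<in> L" and u: "u \<in> U" "a u < 0" for x u
  proof (cases "x = 0")
    case True
    then show ?thesis using pos_b[OF u] u by simp
  next
    case False
    then obtain v where v: "v \<in> U" "b v < 0" and xv: "x = - b v / (a v - b v)"
      using x unfolding L_def by auto
    have "a u * b v \<le> b u * a v" using convex_alternative_cross_le[OF a b max u v] .
    moreover have "0 < a v - b v" "0 < b u - a u"
      using pos_a[OF v] pos_b[OF u] u v by auto
    ultimately show ?thesis unfolding xv
      by (simp add: divide_simps algebra_simps)
  qed
  define l where "l = Sup L"
  have l0: "0 \<le> l" unfolding l_def by (rule cSup_upper[OF _ bdd]) (simp add: L_def)
  have ne: "L \<noteq> {}" by (simp add: L_def)
  have l1: "l \<le> 1" unfolding l_def using ne le1 by (rule cSup_least)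
  have "0 \<le> l * a u + (1 - l) * b u" if u: "u \<in> U" for u
  proof -
    consider "a u < 0" | "b u < 0" | "0 \<le> a u" "0 \<le> b u" by linarith
    then show ?thesis
    proof cases
      case 1
      have "l \<le> b u / (b u - a u)"
        unfolding l_def using ne by (rule cSup_least) (rule up[OF _ u 1])
      then show ?thesis using pos_b[OF u 1] 1 by (simp add: pos_le_divide_eq algebra_simps)
    next
      case 2
      have "- b u / (a u - b u) \<le> l"
        unfolding l_def by (rule cSup_upper[OF _ bdd]) (use u 2 in \<open>auto simp: L_def\<close>)
      moreover have "0 < a u - b u" using pos_a[OF u 2] 2 by simp
      ultimately show ?thesis by (simp only: pos_divide_le_eq) (simp add: algebra_simps)
    next
      case 3
      then show ?thesis using l0 l1 by simp
    qed
  qed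
  with l0 l1 show thesis by (rule that)
qed

lemma convex_on_sum_weighted:
  fixes f :: "'a \<Rightarrow> 'v::real_vector \<Rightarrow> real"
  assumes "convex U" "\<And>p. p \<in> P \<Longrightarrow> convex_on U (f p)" "\<And>p. p \<in> P \<Longrightarrow> 0 \<le> \<pi> p"
  shows "convex_on U (\<lambda>u. \<Sum>p\<in>P. \<pi> p * f p u)"
  using assms
proof (induction P rule: infinite_finite_induct)
  case (insert q P)
  then show ?case by (simp add: convex_on_add convex_on_cmul)
qed (simp_all add: convex_on_const)

lemma convex_alternative_finite:
  fixes f :: "'a \<Rightarrow> 'v::real_vector \<Rightarrow> real"
  assumes "finite P" "P \<noteq> {}" "convex U" "\<And>p. p \<in> P \<Longrightarrow> convex_on U (f p)"
    and "\<And>u. u \<in> U \<Longrightarrow> \<exists>p\<in>P. 0 \<le> f p u"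
  shows "\<exists>\<pi>. (\<forall>p\<in>P. 0 \<le> \<pi> p) \<and> sum \<pi> P = 1 \<and> (\<forall>u\<in>U. 0 \<le> (\<Sum>p\<in>P. \<pi> p * f p u))"
  using assms
\<comment> \<open>\<open>U\<close> varies because the induction hypothesis is applied to the convex
  subset \<open>V\<close> where \<open>f q\<close> is negative. If \<open>V\<close> is empty, it
  still supplies weights.\<close>
proof (induction P arbitrary: U rule: finite_ne_induct)
  case (singleton q)
  then show ?case by (intro exI[of _ "\<lambda>_. 1"]) simp
next
  case (insert q P)
  note q = insert.prems(2)[of q, simplified]
  define V where "V = {u \<in> U. f q u < 0}"
  have V: "convex V"
    unfolding V_def
  proof (rule convexI)
    fix x y and s t :: real
    assume xy: "x \<in> {u \<in> U. f q u < 0}" "y \<in> {u \<in> U. f q u < 0}"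
      and st: "0 \<le> s" "0 \<le> t" "s + t = 1"
    have "f q (s *\<^sub>R x + t *\<^sub>R y) \<le> s * f q x + t * f q y"
      using q xy st unfolding convex_on_def by simp
    also have "\<dots> < 0" using convex_bound_lt[of "f q x" 0 "f q y" s t] xy st by simp
    finally show "s *\<^sub>R x + t *\<^sub>R y \<in> {u \<in> U. f q u < 0}"
      using insert.prems(1) xy st by (simp add: convexD)
  qed
  have "convex_on V (f p)" if "p \<in> P" for p
    using insert.prems(2)[of p] that V by (auto simp: V_def intro: convex_on_subset)
  moreover have "\<exists>p\<in>P. 0 \<le> f p u" if "u \<in> V" for u
    using insert.prems(3)[of u] that by (auto simp: V_def)
  ultimately obtain \<rho> where \<rho>: "\<forall>p\<in>P. 0 \<le> \<rho> p" "sum \<rho> P = 1"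
      "\<forall>u\<in>V. 0 \<le> (\<Sum>p\<in>P. \<rho> p * f p u)"
    using insert.IH[OF V] by blast
  define g where "g u = (\<Sum>p\<in>P. \<rho> p * f p u)" for u
  have "convex_on U g"
    unfolding g_def using insert.prems \<rho>(1) by (intro convex_on_sum_weighted) auto
  \<comment> \<open>On \<open>V\<close> the choice of \<open>\<rho>\<close> makes \<open>g\<close>
    nonnegative; outside \<open>V\<close> it is \<open>f q\<close> that is nonnegative.\<close>
  moreover have "0 \<le> f q u \<or> 0 \<le> g u" if "u \<in> U" for u
    using \<rho>(3) that by (auto simp: V_def g_def)
  ultimately obtain l where l: "0 \<le> l" "l \<le> 1"
      "\<And>u. u \<in> U \<Longrightarrow> 0 \<le> l * f q u + (1 - l) * g u"
    using convex_alternative_two[OF q] by blast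
  define \<pi> where "\<pi> p = (if p = q then l else (1 - l) * \<rho> p)" for p
  have \<pi>P: "(\<Sum>p\<in>P. \<pi> p * h p) = (1 - l) * (\<Sum>p\<in>P. \<rho> p * h p)" for h
    unfolding sum_distrib_left using insert.hyps
    by (intro sum.cong) (auto simp: \<pi>_def)
  have "\<forall>p\<in>insert q P. 0 \<le> \<pi> p" using l \<rho>(1) by (auto simp: \<pi>_def)
  moreover have "sum \<pi> (insert q P) = 1"
    using insert.hyps \<rho>(2) \<pi>P[of "\<lambda>_. 1"] by (simp add: \<pi>_def)
  moreover have "\<forall>u\<in>U. 0 \<le> (\<Sum>p\<in>insert q P. \<pi> p * f p u)"
    using insert.hyps l(3) \<pi>P by (simp add: g_def) (simp add: \<pi>_def)
  ultimately show ?case by blast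
qed

text \<open>Weak duality: at each fixed \<open>u\<close>, an average of the revenues is at most the
  largest of them.\<close>

lemma SUP_INF_le_INF_SUP_prob_simplex:
  fixes R :: "'a \<Rightarrow> 'v \<Rightarrow> real"
  assumes "finite P"
  shows "(SUP \<pi>\<in>prob_simplex P. INF u\<in>U. ereal (\<Sum>p\<in>P. \<pi> p * R p u))
       \<le> (INF u\<in>U. SUP p\<in>P. ereal (R p u))"
proof (intro SUP_least INF_greatest)
  fix \<pi> u assume \<pi>: "\<pi> \<in> prob_simplex P" and u: "u \<in> U"
  have \<pi>': "sum \<pi> P = 1" "\<And>p. p \<in> P \<Longrightarrow> 0 \<le> \<pi> p" using \<pi> by (auto simp: prob_simplex_def)
  have "P \<noteq> {}" using \<pi>'(1) by auto
  define m where "m = Max ((\<lambda>p. R p u) ` P)"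
  have "m \<in> (\<lambda>p. R p u) ` P"
    unfolding m_def using assms \<open>P \<noteq> {}\<close> by (intro Max_in) auto
  then obtain q where q: "q \<in> P" "m = R q u" by blast
  have "(\<Sum>p\<in>P. \<pi> p * R p u) \<le> (\<Sum>p\<in>P. \<pi> p * m)"
    using assms \<pi>' by (intro sum_mono mult_left_mono) (auto simp: m_def)
  also have "\<dots> = R q u" using \<pi>'(1) q by (simp flip: sum_distrib_right)
  finally have "ereal (\<Sum>p\<in>P. \<pi> p * R p u) \<le> ereal (R q u)" by simp
  moreover have "(INF u\<in>U. ereal (\<Sum>p\<in>P. \<pi> p * R p u)) \<le> ereal (\<Sum>p\<in>P. \<pi> p * R p u)"
    using u by (rule INF_lower)
  moreover have "ereal (R q u) \<le> (SUP p\<in>P. ereal (R p u))"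
    using q(1) by (rule SUP_upper)
  ultimately show "(INF u\<in>U. ereal (\<Sum>p\<in>P. \<pi> p * R p u)) \<le> (SUP p\<in>P. ereal (R p u))"
    by (meson order_trans)
qed

text \<open>Every real level \<open>c\<close> strictly below the left side is guaranteed by some
  mixture, namely by the alternative for the functions \<open>R p u - c\<close>. Approaching from
  below requires neither optimum to be attained.\<close>

lemma INF_SUP_le_SUP_INF_prob_simplex:
  fixes R :: "'a \<Rightarrow> 'v::real_vector \<Rightarrow> real"
  assumes "finite P" "P \<noteq> {}" "convex U" "\<And>p. p \<in> P \<Longrightarrow> convex_on U (R p)"
  shows "(INF u\<in>U. SUP p\<in>P. ereal (R p u))
       \<le> (SUP \<pi>\<in>prob_simplex P. INF u\<in>U. ereal (\<Sum>p\<in>P. \<pi> p * R p u))"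
    (is "?I \<le> ?S")
proof (rule dense_le)
  fix y assume y: "y < ?I"
  show "y \<le> ?S"
  proof (cases y)
    case (real c)
    have "\<exists>p\<in>P. 0 \<le> R p u - c" if "u \<in> U" for u
    proof -
      have "ereal c < (SUP p\<in>P. ereal (R p u))"
        using y real INF_lower[OF that, of "\<lambda>u. SUP p\<in>P. ereal (R p u)"] by (simp add: less_le_trans)
      then show ?thesis by (auto simp: less_SUP_iff intro: less_imp_le)
    qed
    moreover have "convex_on U (\<lambda>u. R p u - c)" if "p \<in> P" for p
      using convex_on_add[OF assms(4)[OF that] convex_on_const[of U "- c", THEN iffD2, OF assms(3)]]
      by simp
    ultimately obtain \<pi> where \<pi>: "\<forall>p\<in>P. 0 \<le> \<pi> p" "sum \<pi> P = 1"
        "\<forall>u\<in>U. 0 \<le> (\<Sum>p\<in>P. \<pi> p * (R p u - c))"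
      using convex_alternative_finite[OF assms(1-3), of "\<lambda>p u. R p u - c"] by blast
    \<comment> \<open>The weights \<open>\<pi>\<close> are arbitrary outside \<open>P\<close>,
      whereas elements of \<open>prob_simplex P\<close> must be \<open>undefined\<close>
      there.\<close>
    define \<rho> where "\<rho> = restrict \<pi> P"
    have "\<rho> \<in> prob_simplex P" using \<pi> by (auto simp: prob_simplex_def \<rho>_def)
    moreover have "ereal c \<le> (INF u\<in>U. ereal (\<Sum>p\<in>P. \<rho> p * R p u))"
    proof (rule INF_greatest)
      fix u assume "u \<in> U"
      then have "0 \<le> (\<Sum>p\<in>P. \<pi> p * (R p u - c))" using \<pi>(3) by blast
      also have "\<dots> = (\<Sum>p\<in>P. \<rho> p * R p u) - c"
        using \<pi>(2) by (simp add: \<rho>_def right_diff_distrib sum_subtractf flip: sum_distrib_right)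
      finally show "ereal c \<le> ereal (\<Sum>p\<in>P. \<rho> p * R p u)" by simp
    qed
    ultimately show ?thesis unfolding real by (meson SUP_upper order_trans)
  \<comment> \<open>Plus infinity is not below \<open>?I\<close>, and minus infinity is below
    everything.\<close>
  qed (use y in auto)
qed

text \<open>For fixed \<open>u\<close> the least feasible \<open>t\<close> is the maximum of the
  revenues, a real number attained on the finite nonempty set \<open>P\<close>.\<close>

lemma INF_SUP_eq_INF_epigraph:
  fixes R :: "'a \<Rightarrow> 'v \<Rightarrow> real"
  assumes "finite P" "P \<noteq> {}"
  shows "(INF u\<in>U. SUP p\<in>P. ereal (R p u))
       = (INF (t, u)\<in>{(t :: real, u). u \<in> U \<and> (\<forall>p\<in>P. R p u \<le> t)}. ereal t)"
proof (rule antisym)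
  show "(INF u\<in>U. SUP p\<in>P. ereal (R p u))
      \<le> (INF (t, u)\<in>{(t :: real, u). u \<in> U \<and> (\<forall>p\<in>P. R p u \<le> t)}. ereal t)"
    by (rule INF_greatest) (auto intro!: INF_lower2 SUP_least)
next
  show "(INF (t, u)\<in>{(t :: real, u). u \<in> U \<and> (\<forall>p\<in>P. R p u \<le> t)}. ereal t)
      \<le> (INF u\<in>U. SUP p\<in>P. ereal (R p u))"
  proof (rule INF_greatest)
    fix u assume u: "u \<in> U"
    define m where "m = Max ((\<lambda>p. R p u) ` P)"
    have "m \<in> (\<lambda>p. R p u) ` P"
      unfolding m_def using assms by (intro Max_in) auto
    then have "ereal m \<le> (SUP p\<in>P. ereal (R p u))" by (auto intro: SUP_upper)
    moreover have "(m, u) \<in> {(t, u). u \<in> U \<and> (\<forall>p\<in>P. R p u \<le> t)}"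
      using u assms by (auto simp: m_def)
    ultimately show "(INF (t, u)\<in>{(t :: real, u). u \<in> U \<and> (\<forall>p\<in>P. R p u \<le> t)}. ereal t)
        \<le> (SUP p\<in>P. ereal (R p u))"
      by (intro INF_lower2[of "(m, u)"]) auto
  qed
qed

theorem mainTheorem7:
  fixes P :: "(real ^ 'i) set"
    and U :: "(real ^ 'm) set"
    and R :: "real ^ 'i \<Rightarrow> real ^ 'm \<Rightarrow> real"
  assumes "finite P" and "P \<noteq> {}"
    and "\<And>p i. p \<in> P \<Longrightarrow> 0 \<le> p $ i"
    and "convex U" and "U \<noteq> {}"
    and "\<And>p. p \<in> P \<Longrightarrow> convex_on U (R p)"
  shows "(SUP \<pi>\<in>prob_simplex P. INF u\<in>U. ereal (\<Sum>p\<in>P. \<pi> p * R p u))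
           = (INF u\<in>U. SUP p\<in>P. ereal (R p u))
       \<and> (INF u\<in>U. SUP p\<in>P. ereal (R p u))
           = (INF (t, u)\<in>{(t :: real, u). u \<in> U \<and> (\<forall>p\<in>P. R p u \<le> t)}. ereal t)"
  using assms
  by (intro conjI antisym SUP_INF_le_INF_SUP_prob_simplex INF_SUP_le_SUP_INF_prob_simplex
      eq_refl[OF INF_SUP_eq_INF_epigraph] eq_refl[OF INF_SUP_eq_INF_epigraph[symmetric]])

end
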